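(* As $\alpha\to\infty$, $$\left\|H(\alpha,\cdot)\right\|_{L_\infty[0,\infty)}=\frac{C(\alpha)}{1+2\alpha}\,(1+o(1)).$$
   Context: $C(\alpha)=\int_0^\infty\frac{t^\alpha}{\sinh t}\,dt$ for $\alpha>0$. $H(\alpha,x)=\int_0^\infty \frac{t^\alpha}{\sinh t}\frac{x\sin x}{x^2+t^2}\,dt$ for $\alpha>0$, $x>0$, and $H(\alpha,0)=0$ (its limit as $x\to0^+$). *)

theory Defs
  imports "HOL-Probability.Essential_Supremum" "HOL-Library.Landau_Symbols"
begin

definition C_integral :: "real \<Rightarrow> real" where
  "C_integral \<alpha> = (LINT t:{0<..}|lborel. t powr \<alpha> / sinh t)"

definition H_integral :: "real \<Rightarrow> real \<Rightarrow> real" where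
  "H_integral \<alpha> x =
     (if x = 0 then 0
      else (LINT t:{0<..}|lborel. t powr \<alpha> / sinh t * (x * sin x / (x\<^sup>2 + t\<^sup>2))))"

text \<open>
  The norm is valued in the extended reals, so that an unbounded function gets norm \<open>\<infinity>\<close>
  and not a default real value.
\<close>

definition Linfty_norm :: "real set \<Rightarrow> (real \<Rightarrow> real) \<Rightarrow> ereal" where
  "Linfty_norm S f = esssup (lebesgue_on S) (\<lambda>x. ereal \<bar>f x\<bar>)"

end

theory Submission
  imports Defs "HOL-Real_Asymp.Real_Asymp"
begin

text \<open>
  Up to a factor \<open>1 + O(1/\<alpha>)\<close>, \<open>C(\<alpha>)\<close> is \<open>2\<Gamma>(\<alpha> + 1)\<close>, so \<open>C(\<alpha> - 1)\<close> is about \<open>C(\<alpha>)/\<alpha>\<close> and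
  \<open>C(\<alpha> + 2)\<close> is about \<open>\<alpha>\<^sup>2 C(\<alpha>)\<close>. The upper bound on the norm comes from
  \<open>x / (x\<^sup>2 + t\<^sup>2) \<le> 1 / (2t)\<close>, which gives \<open>\<bar>H(\<alpha>,x)\<bar> \<le> C(\<alpha> - 1)/2\<close>. For the lower bound, the
  tangent line of the convex function \<open>u \<mapsto> x / (x\<^sup>2 + u)\<close> at \<open>u = x\<^sup>2\<close> gives
  \<open>x / (x\<^sup>2 + t\<^sup>2) \<ge> (3x\<^sup>2 - t\<^sup>2) / (4x\<^sup>3)\<close>; integrate this and choose \<open>x\<close> within \<open>2\<pi>\<close> of \<open>\<alpha>\<close>
  such that \<open>sin x = 1\<close>.
\<close>

section \<open>Gamma integrals and two-sided bounds for \<open>C_integral\<close>\<close>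

lemma has_bochner_integral_Gamma:
  assumes "a > 0"
  shows "has_bochner_integral lborel (\<lambda>t::real. indicator {0<..} t *\<^sub>R (t powr (a - 1) * exp (- t))) (Gamma a)"
proof (rule has_bochner_integral_nn_integral)
  have "(\<integral>\<^sup>+t. ennreal (indicator {0<..} t *\<^sub>R (t powr (a - 1) * exp (- t))) \<partial>lborel)
      = (\<integral>\<^sup>+t. ennreal (indicator {0..} t * t powr (a - 1) / exp t) \<partial>lborel)"
    by (intro nn_integral_cong) (auto simp: indicator_def exp_minus field_simps)
  then show "(\<integral>\<^sup>+t. ennreal (indicator {0<..} t *\<^sub>R (t powr (a - 1) * exp (- t))) \<partial>lborel) = ennreal (Gamma a)"
    using Gamma_conv_nn_integral_real[OF assms] by simp
qed (use assms in \<open>auto simp: Gamma_real_pos less_imp_le\<close>)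

lemma set_integrable_Gamma:
  "a > 0 \<Longrightarrow> set_integrable lborel {0<..} (\<lambda>t::real. t powr (a - 1) * exp (- t))"
  using has_bochner_integral_Gamma[of a] unfolding set_integrable_def has_bochner_integral_iff by simp

lemma set_integral_Gamma:
  "a > 0 \<Longrightarrow> (LINT t:{0<..}|lborel. t powr (a - 1) * exp (- t)) = Gamma (a::real)"
  using has_bochner_integral_Gamma[of a]
  unfolding set_lebesgue_integral_def has_bochner_integral_iff by simp

lemma sinh_measurable [measurable]: "(sinh :: real \<Rightarrow> real) \<in> borel_measurable borel"
  by (intro borel_measurable_continuous_onI continuous_intros)

text \<open>Both parts rest on \<open>2 * exp (- t) * sinh t = 1 - exp (- (2 * t))\<close>. The
  second, cleared of denominators, reduces to \<open>1 + 2 * t \<le> exp (2 * t)\<close>. Its error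
  term \<open>exp (- t) / t\<close> costs one power of \<open>t\<close>, so after integration it
  contributes only \<open>Gamma a\<close> next to \<open>2 * Gamma (a + 1)\<close>.\<close>

lemma inverse_sinh_bounds:
  fixes t :: real
  assumes "t > 0"
  shows "2 * exp (- t) \<le> 1 / sinh t" "1 / sinh t \<le> 2 * exp (- t) + exp (- t) / t"
proof -
  have pos: "sinh t > 0" using assms by simp
  have sinh: "sinh t = (exp t - exp (- t)) / 2" by (simp add: sinh_field_def)
  have "2 * exp (- t) * sinh t = 1 - exp (- t) * exp (- t)"
    by (simp add: sinh algebra_simps diff_divide_distrib flip: exp_add)
  also have "\<dots> \<le> 1" by simp
  finally show "2 * exp (- t) \<le> 1 / sinh t"
    using pos by (simp add: field_simps)
  have "1 + 2 * t \<le> exp (2 * t)" by (rule exp_ge_add_one_self)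
  then have "(1 + 2 * t) * exp (- (2 * t)) \<le> exp (2 * t) * exp (- (2 * t))"
    by (intro mult_right_mono) auto
  then have "(1 + 2 * t) * exp (- (2 * t)) \<le> 1" by (simp flip: exp_add)
  moreover have "(2 * t + 1) * exp (- t) * sinh t * 2 = (2 * t + 1) * (1 - exp (- (2 * t)))"
    by (simp add: sinh algebra_simps diff_divide_distrib flip: exp_add)
  ultimately have "t \<le> (2 * t + 1) * exp (- t) * sinh t"
    by (simp add: algebra_simps)
  then show "1 / sinh t \<le> 2 * exp (- t) + exp (- t) / t"
    using pos assms by (simp add: field_simps)
qed

text \<open>The exponent stays in the form \<open>a + 1 - 1\<close> so that the terms match the
  integrand of \<open>set_integral_Gamma\<close> at \<open>a + 1\<close> and at
  \<open>a\<close>.\<close>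

lemma C_integrand_bounds:
  fixes t a :: real
  assumes "t > 0"
  shows "2 * (t powr (a + 1 - 1) * exp (- t)) \<le> t powr a / sinh t"
    and "t powr a / sinh t \<le> 2 * (t powr (a + 1 - 1) * exp (- t)) + t powr (a - 1) * exp (- t)"
proof -
  show "2 * (t powr (a + 1 - 1) * exp (- t)) \<le> t powr a / sinh t"
    using mult_left_mono[OF inverse_sinh_bounds(1)[OF assms], of "t powr a"] by (simp add: mult_ac)
  have "t powr a / sinh t \<le> t powr a * (2 * exp (- t) + exp (- t) / t)"
    using mult_left_mono[OF inverse_sinh_bounds(2)[OF assms], of "t powr a"] by simp
  also have "\<dots> = 2 * (t powr (a + 1 - 1) * exp (- t)) + t powr (a - 1) * exp (- t)"
    using assms by (simp add: powr_diff field_simps)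
  finally show "t powr a / sinh t \<le> 2 * (t powr (a + 1 - 1) * exp (- t)) + t powr (a - 1) * exp (- t)" .
qed

lemma set_integrable_C_majorant:
  "a > 0 \<Longrightarrow> set_integrable lborel {0<..}
    (\<lambda>t::real. 2 * (t powr (a + 1 - 1) * exp (- t)) + t powr (a - 1) * exp (- t))"
  using set_integrable_Gamma[of a] set_integrable_Gamma[of "a + 1"]
  by (intro set_integral_add set_integrable_mult_right) auto

lemma set_integrable_C:
  fixes a :: real
  assumes "a > 0"
  shows "set_integrable lborel {0<..} (\<lambda>t. t powr a / sinh t)"
proof (rule set_integrable_bound[OF set_integrable_C_majorant[OF assms]])
  show "set_borel_measurable lborel {0<..} (\<lambda>t. t powr a / sinh t)"
    unfolding set_borel_measurable_def by measurable
  show "AE t in lborel. t \<in> {0<..} \<longrightarrow> norm (t powr a / sinh t)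
      \<le> norm (2 * (t powr (a + 1 - 1) * exp (- t)) + t powr (a - 1) * exp (- t))"
    using C_integrand_bounds(2)[of _ a] by (intro AE_I2) auto
qed

lemma C_integral_lower:
  assumes "a > 0"
  shows "2 * Gamma (a + 1) \<le> C_integral a"
proof -
  have "2 * Gamma (a + 1) = (LINT t:{0<..}|lborel. 2 * (t powr (a + 1 - 1) * exp (- t)))"
    using set_integral_Gamma[of "a + 1"] assms by simp
  also have "\<dots> \<le> C_integral a"
    unfolding C_integral_def
    by (intro set_integral_mono set_integrable_C assms set_integrable_mult_right set_integrable_Gamma
        C_integrand_bounds(1)) (use assms in auto)
  finally show ?thesis .
qed

lemma C_integral_upper:
  assumes "a > 0"
  shows "C_integral a \<le> 2 * Gamma (a + 1) + Gamma a"
proof -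
  have "C_integral a \<le>
      (LINT t:{0<..}|lborel. 2 * (t powr (a + 1 - 1) * exp (- t)) + t powr (a - 1) * exp (- t))"
    unfolding C_integral_def
    by (intro set_integral_mono set_integrable_C set_integrable_C_majorant assms
        C_integrand_bounds(2)) auto
  also have "\<dots> = (LINT t:{0<..}|lborel. 2 * (t powr (a + 1 - 1) * exp (- t)))
      + (LINT t:{0<..}|lborel. t powr (a - 1) * exp (- t))"
    by (intro set_integral_add(2) set_integrable_mult_right set_integrable_Gamma) (use assms in auto)
  also have "\<dots> = 2 * Gamma (a + 1) + Gamma a"
    using set_integral_Gamma[of "a + 1"] set_integral_Gamma[of a] assms by simp
  finally show ?thesis .
qed

lemma C_integral_pos: "a > 0 \<Longrightarrow> C_integral a > 0"
  using C_integral_lower[of a] Gamma_real_pos[of "a + 1"] by linarith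

text \<open>In units of \<open>Gamma (a - 1)\<close>, the upper bound for
  \<open>C_integral (a - 1)\<close> is \<open>2 * a - 1\<close> and the lower bound for
  \<open>C_integral a\<close> is \<open>2 * a * (a - 1)\<close>.\<close>

lemma C_integral_pred_le:
  assumes "a > 1"
  shows "C_integral (a - 1) \<le> C_integral a / (a - 1)"
proof -
  have G: "Gamma (a + 1) = a * (a - 1) * Gamma (a - 1)" "Gamma a = (a - 1) * Gamma (a - 1)"
    using Gamma_plus1[of a] Gamma_plus1[of "a - 1"] assms by (auto simp: nonpos_Ints_def)
  have "C_integral (a - 1) \<le> 2 * Gamma a + Gamma (a - 1)"
    using C_integral_upper[of "a - 1"] assms by simp
  also have "\<dots> \<le> 2 * a * Gamma (a - 1)"
    using Gamma_real_pos[of "a - 1"] assms by (simp add: G algebra_simps)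
  also have "\<dots> = 2 * Gamma (a + 1) / (a - 1)" using assms by (simp add: G)
  also have "\<dots> \<le> C_integral a / (a - 1)"
    using C_integral_lower[of a] assms by (intro divide_right_mono) auto
  finally show ?thesis .
qed

text \<open>In units of \<open>Gamma (a + 1)\<close>, the upper bound for
  \<open>C_integral (a + 2)\<close> is \<open>(a + 1) * (2 * a + 5)\<close>; rounding 5 up to 6
  gives the factor \<open>a + 3\<close>.\<close>

lemma C_integral_plus2_le:
  assumes "a > 0"
  shows "C_integral (a + 2) \<le> (a + 1) * (a + 3) * C_integral a"
proof -
  have G: "Gamma (a + 3) = (a + 2) * Gamma (a + 2)" "Gamma (a + 2) = (a + 1) * Gamma (a + 1)"
    using Gamma_plus1[of "a + 2"] Gamma_plus1[of "a + 1"] assms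
    by (auto simp: nonpos_Ints_def add_ac)
  have "C_integral (a + 2) \<le> 2 * Gamma (a + 3) + Gamma (a + 2)"
    using C_integral_upper[of "a + 2"] assms by (simp add: add_ac)
  also have "\<dots> \<le> (a + 1) * (a + 3) * (2 * Gamma (a + 1))"
    using Gamma_real_pos[of "a + 1"] assms by (simp add: G algebra_simps)
  also have "\<dots> \<le> (a + 1) * (a + 3) * C_integral a"
    using C_integral_lower[of a] assms by (intro mult_left_mono) auto
  finally show ?thesis .
qed

section \<open>Kernel estimates and pointwise bounds for \<open>H_integral\<close>\<close>

lemma kernel_le:
  fixes x t :: real
  assumes "t > 0" "x \<ge> 0"
  shows "x / (x\<^sup>2 + t\<^sup>2) \<le> 1 / (2 * t)"
proof -
  have "0 < x\<^sup>2 + t\<^sup>2" using assms by (simp add: add_nonneg_pos)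
  moreover have "0 \<le> (x - t)\<^sup>2" by simp
  ultimately show ?thesis
    using assms by (simp add: field_simps power2_eq_square)
qed

text \<open>Cross-multiplied, the two sides differ by exactly
  \<open>(x\<^sup>2 - t\<^sup>2)\<^sup>2\<close>. The minorant is linear in
  \<open>t\<^sup>2\<close>, so integrating it involves only \<open>C_integral a\<close> and
  \<open>C_integral (a + 2)\<close>. Like \<open>kernel_le\<close>, it is sharp at
  \<open>t = x\<close>, which is why the two bounds on the norm agree to leading order.\<close>

lemma kernel_ge:
  fixes x t :: real
  assumes "x > 0"
  shows "(3 * x\<^sup>2 - t\<^sup>2) / (4 * x ^ 3) \<le> x / (x\<^sup>2 + t\<^sup>2)"
proof -
  have pos: "0 < x\<^sup>2 + t\<^sup>2" using assms by (simp add: add_pos_nonneg)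
  have "0 \<le> (x\<^sup>2 - t\<^sup>2)\<^sup>2" by simp
  then have "(3 * x\<^sup>2 - t\<^sup>2) * (x\<^sup>2 + t\<^sup>2) \<le> x * (4 * x ^ 3)"
    by (simp add: power2_eq_square power3_eq_cube algebra_simps)
  then show ?thesis using pos assms by (simp add: pos_divide_le_eq pos_le_divide_eq)
qed

lemma H_integrand_abs_le:
  fixes a x t :: real
  assumes "t > 0" "x \<ge> 0"
  shows "\<bar>t powr a / sinh t * (x * sin x / (x\<^sup>2 + t\<^sup>2))\<bar> \<le> (1 / 2) * (t powr (a - 1) / sinh t)"
proof -
  have "\<bar>x * sin x / (x\<^sup>2 + t\<^sup>2)\<bar> = \<bar>sin x\<bar> * (x / (x\<^sup>2 + t\<^sup>2))"
    using assms by (simp add: abs_mult)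
  also have "\<dots> \<le> 1 * (1 / (2 * t))"
    using assms kernel_le[OF assms] by (intro mult_mono) auto
  finally have "t powr a / sinh t * \<bar>x * sin x / (x\<^sup>2 + t\<^sup>2)\<bar> \<le> t powr a / sinh t * (1 / (2 * t))"
    using assms by (intro mult_left_mono) auto
  then show ?thesis
    using assms by (simp add: abs_mult powr_diff mult_ac)
qed

text \<open>The majorant has exponent \<open>a - 1\<close>, which \<open>a > 1\<close> makes
  positive as \<open>set_integrable_C\<close> requires.\<close>

lemma set_integrable_H:
  fixes a x :: real
  assumes "a > 1" "x \<ge> 0"
  shows "set_integrable lborel {0<..} (\<lambda>t. t powr a / sinh t * (x * sin x / (x\<^sup>2 + t\<^sup>2)))"
proof (rule set_integrable_bound)
  show "set_integrable lborel {0<..} (\<lambda>t. (1 / 2) * (t powr (a - 1) / sinh t))"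
    using assms by (intro set_integrable_mult_right set_integrable_C) auto
  show "set_borel_measurable lborel {0<..} (\<lambda>t. t powr a / sinh t * (x * sin x / (x\<^sup>2 + t\<^sup>2)))"
    unfolding set_borel_measurable_def by measurable
  show "AE t in lborel. t \<in> {0<..} \<longrightarrow> norm (t powr a / sinh t * (x * sin x / (x\<^sup>2 + t\<^sup>2)))
      \<le> norm ((1 / 2) * (t powr (a - 1) / sinh t))"
  proof (intro AE_I2 impI)
    fix t :: real assume "t \<in> {0<..}"
    then show "norm (t powr a / sinh t * (x * sin x / (x\<^sup>2 + t\<^sup>2)))
      \<le> norm ((1 / 2) * (t powr (a - 1) / sinh t))"
      using H_integrand_abs_le[of t x a] assms
      unfolding real_norm_def by (auto intro: order_trans[OF _ abs_ge_self])
  qed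
qed

lemma H_integral_abs_le:
  assumes "a > 1" "x \<ge> 0"
  shows "\<bar>H_integral a x\<bar> \<le> C_integral (a - 1) / 2"
proof (cases "x = 0")
  case True
  then show ?thesis using C_integral_pos[of "a - 1"] assms by (simp add: H_integral_def)
next
  case False
  have "\<bar>H_integral a x\<bar> \<le> (LINT t:{0<..}|lborel. \<bar>t powr a / sinh t * (x * sin x / (x\<^sup>2 + t\<^sup>2))\<bar>)"
    using False set_integral_norm_bound[OF set_integrable_H[OF assms]] by (simp add: H_integral_def)
  also have "\<dots> \<le> (LINT t:{0<..}|lborel. (1 / 2) * (t powr (a - 1) / sinh t))"
    using assms
    by (intro set_integral_mono set_integrable_abs set_integrable_H set_integrable_mult_right
        set_integrable_C H_integrand_abs_le) auto
  also have "\<dots> = C_integral (a - 1) / 2"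
    unfolding C_integral_def by (subst set_integral_mult_right) simp
  finally show ?thesis .
qed

lemma H_integral_ge:
  assumes "a > 1" "x > 0" "sin x \<ge> 0"
  shows "sin x * ((3 * x\<^sup>2 * C_integral a - C_integral (a + 2)) / (4 * x ^ 3)) \<le> H_integral a x"
proof -
  \<comment> \<open>These are the coefficients of \<open>C_integral a\<close> and
    \<open>C_integral (a + 2)\<close> after \<open>kernel_ge\<close> is multiplied by
    \<open>sin x\<close>; the sign of \<open>sin x\<close> preserves the inequality.\<close>
  define p q where "p = sin x * (3 * x\<^sup>2) / (4 * x ^ 3)" and "q = sin x / (4 * x ^ 3)"
  have int: "set_integrable lborel {0<..} (\<lambda>t. p * (t powr a / sinh t))"
      "set_integrable lborel {0<..} (\<lambda>t. q * (t powr (a + 2) / sinh t))"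
    using assms by (intro set_integrable_mult_right set_integrable_C; simp)+
  have "sin x * ((3 * x\<^sup>2 * C_integral a - C_integral (a + 2)) / (4 * x ^ 3))
      = p * C_integral a - q * C_integral (a + 2)"
    by (simp add: p_def q_def diff_divide_distrib algebra_simps)
  also have "\<dots> = (LINT t:{0<..}|lborel. p * (t powr a / sinh t) - q * (t powr (a + 2) / sinh t))"
    by (subst set_integral_diff(2)[OF int]) (simp only: set_integral_mult_right C_integral_def)
  also have "\<dots> \<le> (LINT t:{0<..}|lborel. t powr a / sinh t * (x * sin x / (x\<^sup>2 + t\<^sup>2)))"
  proof (intro set_integral_mono set_integral_diff(1) int set_integrable_H)
    fix t :: real assume "t \<in> {0<..}"
    then have t: "t > 0" by simp
    have "p * (t powr a / sinh t) - q * (t powr (a + 2) / sinh t)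
        = t powr a / sinh t * (sin x * ((3 * x\<^sup>2 - t\<^sup>2) / (4 * x ^ 3)))"
      using t by (simp add: p_def q_def powr_add diff_divide_distrib algebra_simps)
    also have "\<dots> \<le> t powr a / sinh t * (sin x * (x / (x\<^sup>2 + t\<^sup>2)))"
      using t assms by (intro mult_left_mono kernel_ge) auto
    finally show "p * (t powr a / sinh t) - q * (t powr (a + 2) / sinh t)
        \<le> t powr a / sinh t * (x * sin x / (x\<^sup>2 + t\<^sup>2))" by (simp add: mult_ac)
  qed (use assms in auto)
  also have "\<dots> = H_integral a x" using assms by (simp add: H_integral_def)
  finally show ?thesis .
qed

text \<open>The integrand is jointly measurable in \<open>x\<close> and \<open>t\<close>, and
  \<open>lborel\<close> is sigma-finite. The upper bound on the norm relies on this, since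
  \<open>esssup\<close> is top on nonmeasurable functions.\<close>

lemma H_integral_measurable [measurable]: "H_integral a \<in> borel_measurable borel"
proof -
  have "(\<lambda>x. LINT t|lborel. indicator {0<..} t *\<^sub>R (t powr a / sinh t * (x * sin x / (x\<^sup>2 + t\<^sup>2))))
      \<in> borel_measurable borel"
    by (rule lborel.borel_measurable_lebesgue_integral) measurable
  then show ?thesis
    unfolding H_integral_def[abs_def] set_lebesgue_integral_def by measurable
qed

section \<open>Bounding the essential supremum from both sides\<close>

lemma Linfty_norm_le:
  assumes "f \<in> borel_measurable (lebesgue_on S)" "S \<in> sets lebesgue" "\<And>x. x \<in> S \<Longrightarrow> \<bar>f x\<bar> \<le> c"
  shows "Linfty_norm S f \<le> ereal c"
  unfolding Linfty_norm_def
  by (rule esssup_I) (use assms in \<open>auto simp: AE_restrict_space_iff\<close>)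

text \<open>A value at one point does not bound an essential supremum from below, but a continuous
  minorant near that point does: if the norm \<open>z\<close> were below \<open>g x\<close>, the set
  where \<open>g\<close> exceeds \<open>z\<close> would be open and nonempty, hence not null,
  although \<bar>f\<bar> exceeds \<open>z\<close> on it. Putting the continuity into
  \<open>g\<close> spares a proof that \<open>H_integral a\<close> is continuous.\<close>

lemma Linfty_norm_ge:
  fixes g :: "real \<Rightarrow> real"
  assumes S: "S \<in> sets lebesgue"
    and U: "open U" "x \<in> U" "U \<subseteq> S" "continuous_on U g"
    and le: "\<And>y. y \<in> U \<Longrightarrow> g y \<le> \<bar>f y\<bar>"
  shows "ereal (g x) \<le> Linfty_norm S f"
proof (rule ccontr)
  define z where "z = Linfty_norm S f"
  assume "\<not> ereal (g x) \<le> Linfty_norm S f"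
  then have z: "z < ereal (g x)" by (simp add: z_def)
  define V where "V = {y \<in> U. z < ereal (g y)}"
  have "V = U \<inter> (\<lambda>y. ereal (g y)) -` {z<..}" by (auto simp: V_def)
  then have "open V"
    using U by (auto intro!: continuous_open_preimage continuous_intros)
  moreover have "V \<noteq> {}" using z U by (auto simp: V_def)
  ultimately have "\<not> negligible V" by (rule open_not_negligible)
  moreover have "AE y in lebesgue_on S. ereal \<bar>f y\<bar> \<le> z"
    unfolding z_def Linfty_norm_def by (rule esssup_AE)
  then have "AE y in lebesgue. y \<in> S \<longrightarrow> ereal \<bar>f y\<bar> \<le> z"
    using S by (simp add: AE_restrict_space_iff)
  then have "AE y in lebesgue. y \<notin> V"
  proof eventually_elim
    case (elim y)
    show ?case
    proof
      assume y: "y \<in> V"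
      then have "z < ereal (g y)" "ereal (g y) \<le> ereal \<bar>f y\<bar>"
        using le by (auto simp: V_def)
      moreover have "ereal \<bar>f y\<bar> \<le> z" using elim y U by (auto simp: V_def)
      ultimately show False by (meson leD less_le_trans order_trans)
    qed
  qed
  then have "V \<in> null_sets lebesgue"
    using \<open>open V\<close> by (subst AE_iff_null_sets) auto
  ultimately show False by (simp add: negligible_iff_null_sets)
qed

section \<open>Explicit bounds for the norm, and their asymptotics\<close>

lemma Linfty_norm_H_le:
  assumes "a > 1"
  shows "Linfty_norm {0..} (H_integral a) \<le> ereal (C_integral a / (2 * (a - 1)))"
proof (rule Linfty_norm_le)
  show "H_integral a \<in> borel_measurable (lebesgue_on {0..})"
    by (intro measurable_restrict_space1 measurable_completion) simp
  show "\<bar>H_integral a x\<bar> \<le> C_integral a / (2 * (a - 1))" if "x \<in> {0..}" for x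
  proof -
    have "\<bar>H_integral a x\<bar> \<le> C_integral (a - 1) / 2"
      using H_integral_abs_le that assms by simp
    also have "\<dots> \<le> C_integral a / (a - 1) / 2"
      using C_integral_pred_le assms by (intro divide_right_mono) auto
    also have "\<dots> = C_integral a / (2 * (a - 1))" by (simp add: mult_ac)
    finally show ?thesis .
  qed
qed auto

lemma ex_sin_eq_1: "\<exists>x. a \<le> x \<and> x \<le> a + 2 * pi \<and> sin x = 1"
proof -
  \<comment> \<open>The least integer for which \<open>pi / 2 + 2 * pi * n\<close> is at least
    \<open>a\<close>.\<close>
  define n where "n = \<lceil>(a - pi / 2) / (2 * pi)\<rceil>"
  define x where "x = pi / 2 + 2 * pi * of_int n"
  have "(a - pi / 2) / (2 * pi) \<le> of_int n" "of_int n \<le> (a - pi / 2) / (2 * pi) + 1"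
    unfolding n_def by linarith+
  then have "a \<le> x" "x \<le> a + 2 * pi"
    by (auto simp: x_def field_simps)
  moreover have "sin x = 1"
    by (simp add: x_def sin_add cos_int_2pin)
  ultimately show ?thesis by blast
qed

lemma Linfty_norm_H_ge:
  assumes a: "a > 1" and pos: "(a + 1) * (a + 3) \<le> 3 * a\<^sup>2"
  shows "ereal (C_integral a * ((3 * a\<^sup>2 - (a + 1) * (a + 3)) / (4 * (a + 2 * pi) ^ 3)))
    \<le> Linfty_norm {0..} (H_integral a)"
proof -
  obtain x where x: "a \<le> x" "x \<le> a + 2 * pi" "sin x = 1" using ex_sin_eq_1 by blast
  \<comment> \<open>\<open>g\<close> is the minorant from \<open>H_integral_ge\<close>, and
    \<open>U\<close> is an open set around \<open>x\<close> on which the sign condition on the sine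
    holds.\<close>
  define g where "g y = sin y * ((3 * y\<^sup>2 * C_integral a - C_integral (a + 2)) / (4 * y ^ 3))" for y
  define U where "U = {0<..} \<inter> {y::real. 0 < sin y}"
  have C: "C_integral a > 0" using C_integral_pos a by simp
  have "a\<^sup>2 \<le> x\<^sup>2" using x a by (intro power_mono) auto
  \<comment> \<open>The numerator is estimated at \<open>x = a\<close>, the denominator at
    \<open>x = a + 2 * pi\<close>. By \<open>pos\<close> the numerator at \<open>x\<close> is
    nonnegative, so enlarging the denominator can only decrease the quotient.\<close>
  then have "(3 * a\<^sup>2 - (a + 1) * (a + 3)) / (4 * (a + 2 * pi) ^ 3)
      \<le> (3 * x\<^sup>2 - (a + 1) * (a + 3)) / (4 * x ^ 3)"
    using x a order_trans[OF pos, of "3 * x\<^sup>2"]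
    by (intro frac_le mult_left_mono diff_right_mono power_mono) auto
  then have "C_integral a * ((3 * a\<^sup>2 - (a + 1) * (a + 3)) / (4 * (a + 2 * pi) ^ 3))
      \<le> C_integral a * ((3 * x\<^sup>2 - (a + 1) * (a + 3)) / (4 * x ^ 3))"
    using C by (intro mult_left_mono) auto
  also have "\<dots> = (3 * x\<^sup>2 * C_integral a - (a + 1) * (a + 3) * C_integral a) / (4 * x ^ 3)"
    by (simp add: algebra_simps)
  also have "\<dots> \<le> g x"
    using x a C_integral_plus2_le[of a]
    by (auto simp: g_def intro!: divide_right_mono)
  finally have "ereal (C_integral a * ((3 * a\<^sup>2 - (a + 1) * (a + 3)) / (4 * (a + 2 * pi) ^ 3)))
      \<le> ereal (g x)" by simp
  also have "\<dots> \<le> Linfty_norm {0..} (H_integral a)"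
  proof (rule Linfty_norm_ge[where g = g and U = U])
    show "open U" unfolding U_def by (intro open_Int open_Collect_less continuous_intros)
    show "continuous_on U g"
      unfolding g_def[abs_def] U_def by (intro continuous_intros) auto
    show "g y \<le> \<bar>H_integral a y\<bar>" if "y \<in> U" for y
      using H_integral_ge[of a y] that a by (auto simp: g_def U_def)
  qed (use x a in \<open>auto simp: U_def\<close>)
  finally show ?thesis .
qed

theorem theorem5p3:
  "\<exists>\<epsilon> :: real \<Rightarrow> real. \<epsilon> \<in> o[at_top](\<lambda>_. 1) \<and>
     (\<forall>\<^sub>F \<alpha> in at_top. Linfty_norm {0..} (H_integral \<alpha>) =
        ereal (C_integral \<alpha> / (1 + 2 * \<alpha>) * (1 + \<epsilon> \<alpha>)))"
proof -
  define N where "N a = real_of_ereal (Linfty_norm {0..} (H_integral a))" for a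
  \<comment> \<open>\<open>r\<close> is the norm divided by its claimed main term, so the witness
    for the error is \<open>r a - 1\<close>. \<open>l\<close> and \<open>u\<close> are the two norm
    bounds rescaled in the same way; both tend to 1, for \<open>l\<close> because its leading terms
    are \<open>2 * a\<close> times \<open>2 * a\<^sup>2 / (4 * a ^ 3)\<close>.\<close>
  define r where "r a = N a * (1 + 2 * a) / C_integral a" for a
  define l where "l a = (1 + 2 * a) * ((3 * a\<^sup>2 - (a + 1) * (a + 3)) / (4 * (a + 2 * pi) ^ 3))" for a :: real
  define u where "u a = (1 + 2 * a) / (2 * (a - 1))" for a :: real
  have "\<forall>\<^sub>F a::real in at_top. a > 1 \<and> (a + 1) * (a + 3) \<le> 3 * a\<^sup>2"
    by (intro eventually_conj; real_asymp)
  then have ev: "\<forall>\<^sub>F a in at_top. Linfty_norm {0..} (H_integral a) = ereal (N a)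
      \<and> C_integral a > 0 \<and> 1 + 2 * a > 0 \<and> l a \<le> r a \<and> r a \<le> u a"
  proof eventually_elim
    case (elim a)
    then have C: "C_integral a > 0" using C_integral_pos by simp
    have lo: "ereal (C_integral a * ((3 * a\<^sup>2 - (a + 1) * (a + 3)) / (4 * (a + 2 * pi) ^ 3)))
        \<le> Linfty_norm {0..} (H_integral a)"
      using Linfty_norm_H_ge elim by blast
    have up: "Linfty_norm {0..} (H_integral a) \<le> ereal (C_integral a / (2 * (a - 1)))"
      using Linfty_norm_H_le elim by blast
    \<comment> \<open>Lying between two real numbers, the norm is finite, so
      \<open>real_of_ereal\<close> does not fall back on its default value.\<close>
    have N: "Linfty_norm {0..} (H_integral a) = ereal (N a)"
      using lo up unfolding N_def by (cases "Linfty_norm {0..} (H_integral a)") auto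
    have "l a * C_integral a \<le> N a * (1 + 2 * a)"
      using mult_right_mono[OF lo[unfolded N ereal_less_eq], of "1 + 2 * a"] elim
      by (simp add: l_def mult_ac)
    moreover have "N a * (1 + 2 * a) \<le> u a * C_integral a"
      using mult_right_mono[OF up[unfolded N ereal_less_eq], of "1 + 2 * a"] elim
      by (simp add: u_def mult_ac)
    ultimately show ?case
      using C N elim by (auto simp: r_def pos_divide_le_eq pos_le_divide_eq)
  qed
  have "(r \<longlongrightarrow> 1) at_top"
  proof (rule tendsto_sandwich)
    show "(l \<longlongrightarrow> 1) at_top" unfolding l_def by real_asymp
    show "(u \<longlongrightarrow> 1) at_top" unfolding u_def by real_asymp
  qed (use ev in \<open>auto elim: eventually_mono\<close>)
  then have "((\<lambda>a. (r a - 1) / 1) \<longlongrightarrow> 0) at_top"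
    by (auto intro!: tendsto_eq_intros)
  then have "(\<lambda>a. r a - 1) \<in> o[at_top](\<lambda>_. 1)"
    by (intro smalloI_tendsto) auto
  moreover from ev have "\<forall>\<^sub>F a in at_top. Linfty_norm {0..} (H_integral a) =
      ereal (C_integral a / (1 + 2 * a) * (1 + (r a - 1)))"
    by eventually_elim (simp add: r_def)
  ultimately show ?thesis by blast
qed

end
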